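(* For any graph $G$ of order $n\geqslant 5$, $n\leqslant \chi_i(G)\chi_i(\overline{G})\leqslant n^2$, where $\overline{G}$ is the complement of $G$.
   Context: All graphs are finite and simple; the order of a graph is its number of vertices, and $\overline{G}$ denotes the complement of $G$. A mapping $f:V(G)\to\{1,\ldots,k\}$ is an injective $k$-coloring of $G$ if $f(u)\neq f(v)$ whenever the distinct vertices $u$ and $v$ have a common neighbor in $G$ (adjacent vertices without a common neighbor may receive the same color). The injective chromatic number $\chi_i(G)$ is the minimum $k$ such that $G$ has an injective $k$-coloring. *)

theory Defs
  imports "Graph_Theory.Pair_Digraph"
begin

text \<open>
  Finite simple graphs are the symmetric, loop-free, finite digraphs without parallel arcs of
  locale \<^locale>\<open>pair_graph\<close>: an undirected edge \<open>uv\<close> is the pair of arcs \<open>(u, v)\<close>, \<open>(v, u)\<close>.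
\<close>

definition graph_order :: "'a pair_pre_digraph \<Rightarrow> nat" where
  "graph_order G = card (pverts G)"

definition graph_complement :: "'a pair_pre_digraph \<Rightarrow> 'a pair_pre_digraph" where
  "graph_complement G =
     \<lparr> pverts = pverts G,
       parcs = {(u, v). u \<in> pverts G \<and> v \<in> pverts G \<and> u \<noteq> v \<and> (u, v) \<notin> parcs G} \<rparr>"

definition has_common_neighbor :: "'a pair_pre_digraph \<Rightarrow> 'a \<Rightarrow> 'a \<Rightarrow> bool" where
  "has_common_neighbor G u v \<longleftrightarrow> (\<exists>w\<in>pverts G. (u, w) \<in> parcs G \<and> (v, w) \<in> parcs G)"

definition injective_coloring :: "'a pair_pre_digraph \<Rightarrow> nat \<Rightarrow> ('a \<Rightarrow> nat) \<Rightarrow> bool" where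
  "injective_coloring G k f \<longleftrightarrow>
     f ` pverts G \<subseteq> {1..k} \<and>
     (\<forall>u\<in>pverts G. \<forall>v\<in>pverts G. u \<noteq> v \<longrightarrow> has_common_neighbor G u v \<longrightarrow> f u \<noteq> f v)"

definition injective_chromatic_number :: "'a pair_pre_digraph \<Rightarrow> nat" where
  "injective_chromatic_number G = (LEAST k. \<exists>f. injective_coloring G k f)"

lemma pair_graph_graph_complement:
  assumes "pair_graph G"
  shows "pair_graph (graph_complement G)"
proof -
  interpret pair_graph G by (rule assms)
  let ?H = "graph_complement G"
  have arc_H: "(u, v) \<in> parcs ?H \<longleftrightarrow> u \<in> pverts G \<and> v \<in> pverts G \<and> u \<noteq> v \<and> (u, v) \<notin> parcs G" for u v
    by (simp add: graph_complement_def)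
  have verts_H: "pverts ?H = pverts G"
    by (simp add: graph_complement_def)
  have "finite (parcs ?H)"
    by (rule finite_subset[of _ "pverts G \<times> pverts G"])
       (auto simp: graph_complement_def pair_finite_verts)
  moreover have "sym (parcs ?H)"
    using arcs_symmetric by (intro symI) (simp only: arc_H, blast)
  moreover have "fst e \<in> pverts ?H" "snd e \<in> pverts ?H" "fst e \<noteq> snd e" if "e \<in> parcs ?H" for e
    using that by (cases e; simp add: arc_H verts_H)+
  ultimately show ?thesis
    using pair_finite_verts
    by unfold_locales (simp_all add: verts_H symmetric_def)
qed

lemma injective_chromatic_number_attained:
  assumes "finite (pverts G)"
  shows "\<exists>f. injective_coloring G (injective_chromatic_number G) f"
proof -
  obtain g where g: "bij_betw g (pverts G) {1..card (pverts G)}"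
    using finite_same_card_bij[OF assms, of "{1..card (pverts G)}"] by auto
  then have "injective_coloring G (card (pverts G)) g"
    by (auto simp: injective_coloring_def bij_betw_def dest: inj_onD)
  then show ?thesis
    unfolding injective_chromatic_number_def
    by (rule LeastI[where P = "\<lambda>k. \<exists>f. injective_coloring G k f", OF exI])
qed

end

theory Submission
  imports Defs
begin

text \<open>
  Pairing an optimal injective coloring of \<open>G\<close> with one of its complement either separates all
  vertices, which gives the lower bound at once, or identifies two vertices \<open>u \<noteq> v\<close> having no
  common neighbor in either graph. In the latter case the remaining \<open>n - 2\<close> vertices split into
  \<open>A\<close> (adjacent to \<open>u\<close> only) and \<open>B\<close> (adjacent to \<open>v\<close> only), each of which is rainbow in both
  graphs; and in the graph where \<open>u\<close> and \<open>v\<close> are adjacent, even \<open>A \<union> {v}\<close> and \<open>B \<union> {u}\<close> are. With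
  \<open>m = max |A| |B|\<close>, the product is at least \<open>m (m + 1) \<ge> 2 m + 2 \<ge> n\<close>, as \<open>n \<ge> 5\<close> forces \<open>m \<ge> 2\<close>.
\<close>

lemma pverts_graph_complement [simp]: "pverts (graph_complement G) = pverts G"
  by (simp add: graph_complement_def)

lemma parcs_graph_complement_iff:
  "(u, v) \<in> parcs (graph_complement G) \<longleftrightarrow>
     u \<in> pverts G \<and> v \<in> pverts G \<and> u \<noteq> v \<and> (u, v) \<notin> parcs G"
  by (simp add: graph_complement_def)

text \<open>Giving all vertices distinct colors is an injective coloring whatever the arcs are. Used
  for both graphs, this yields the upper bound \<open>n ^ 2\<close>.\<close>

lemma injective_chromatic_number_le_card:
  assumes "finite (pverts G)"
  shows "injective_chromatic_number G \<le> card (pverts G)"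
proof -
  obtain g where "bij_betw g (pverts G) {1..card (pverts G)}"
    using finite_same_card_bij[OF assms, of "{1..card (pverts G)}"] by auto
  then have "injective_coloring G (card (pverts G)) g"
    by (auto simp: injective_coloring_def bij_betw_def dest: inj_onD)
  then show ?thesis
    unfolding injective_chromatic_number_def by (intro Least_le exI)
qed

text \<open>Any two vertices of \<open>S\<close> share the neighbor \<open>w\<close>, so an optimal
  injective coloring is injective on \<open>S\<close>.\<close>

lemma card_neighbors_le_injective_chromatic_number:
  assumes "finite (pverts G)" "w \<in> pverts G" "S \<subseteq> pverts G"
    and adj: "\<And>s. s \<in> S \<Longrightarrow> (s, w) \<in> parcs G"
  shows "card S \<le> injective_chromatic_number G"
proof -
  obtain f where f: "injective_coloring G (injective_chromatic_number G) f"
    using injective_chromatic_number_attained[OF assms(1)] by blast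
  have "inj_on f S"
  proof (rule inj_onI, rule ccontr)
    fix x y assume "x \<in> S" "y \<in> S" "f x = f y" "x \<noteq> y"
    moreover have "has_common_neighbor G x y"
      using adj \<open>x \<in> S\<close> \<open>y \<in> S\<close> assms(2) by (auto simp: has_common_neighbor_def)
    ultimately show False
      using f assms(3) by (auto simp: injective_coloring_def)
  qed
  moreover have "f ` S \<subseteq> {1..injective_chromatic_number G}"
    using f assms(3) by (auto simp: injective_coloring_def)
  ultimately show ?thesis
    using card_inj_on_le[of f S "{1..injective_chromatic_number G}"] by simp
qed

text \<open>Here \<open>x\<close> and \<open>y\<close> stand for the sizes of \<open>A\<close> and
  \<open>B\<close>, the summand 2 counts \<open>u\<close> and \<open>v\<close>, and \<open>a\<close>
  belongs to whichever graph has \<open>u\<close> and \<open>v\<close> adjacent.\<close>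

lemma le_mult_if_split_le:
  fixes a b x y :: nat
  assumes "x + 1 \<le> a" "y + 1 \<le> a" "x \<le> b" "y \<le> b" "5 \<le> x + y + 2"
  shows "x + y + 2 \<le> a * b"
proof -
  define m where "m = max x y"
  \<comment> \<open>Since \<open>x + y\<close> is at least 3, the larger of the two is at least 2;
    hence \<open>b\<close> is at least 2 and supplies the factor 2.\<close>
  have m: "m + 1 \<le> a" "m \<le> b" "x + y + 2 \<le> (m + 1) * 2" "2 \<le> m"
    using assms by (auto simp: m_def)
  note m(3)
  also have "(m + 1) * 2 \<le> a * b"
    using m by (intro mult_le_mono) auto
  finally show ?thesis .
qed

lemma card_le_mult_injective_chromatic_number_if_no_common_neighbor:
  assumes "pair_graph G" "card (pverts G) \<ge> 5"
    and uv: "u \<in> pverts G" "v \<in> pverts G" "u \<noteq> v"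
    and no: "\<not> has_common_neighbor G u v" "\<not> has_common_neighbor (graph_complement G) u v"
  shows "card (pverts G) \<le>
    injective_chromatic_number G * injective_chromatic_number (graph_complement G)"
proof -
  interpret pair_graph G by (rule assms)
  let ?H = "graph_complement G"
  let ?a = "injective_chromatic_number G" and ?b = "injective_chromatic_number ?H"
  have sym: "(x, y) \<in> parcs G \<longleftrightarrow> (y, x) \<in> parcs G" for x y
    using arcs_symmetric by blast
  define A where "A = {w \<in> pverts G - {u, v}. (w, u) \<in> parcs G}"
  define B where "B = {w \<in> pverts G - {u, v}. (w, v) \<in> parcs G}"
  have fin: "finite A" "finite B" and mem: "u \<notin> A" "v \<notin> A" "u \<notin> B" "v \<notin> B"
    by (auto simp: A_def B_def)
  have sub: "A \<subseteq> pverts G" "B \<subseteq> pverts G" by (auto simp: A_def B_def)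
  \<comment> \<open>Adjacent to both, \<open>w\<close> would be a common neighbor in
    \<open>G\<close>; adjacent to neither, one in the complement.\<close>
  have one: "(w, u) \<in> parcs G \<longleftrightarrow> (w, v) \<notin> parcs G" if "w \<in> pverts G" "w \<noteq> u" "w \<noteq> v" for w
    using no that uv sym
    by (auto simp: has_common_neighbor_def parcs_graph_complement_iff)
  have "pverts G = insert u (insert v (A \<union> B))" and "A \<inter> B = {}"
    using one uv by (auto simp: A_def B_def)
  then have n: "card (pverts G) = card A + card B + 2"
    using fin mem uv by (simp add: card_Un_disjoint)
  have GA: "(s, u) \<in> parcs G" and HA: "(s, v) \<in> parcs ?H" if "s \<in> A" for s
    using that one uv by (auto simp: A_def parcs_graph_complement_iff)
  have GB: "(s, v) \<in> parcs G" and HB: "(s, u) \<in> parcs ?H" if "s \<in> B" for s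
    using that one uv by (auto simp: B_def parcs_graph_complement_iff)
  have nbG: "card S \<le> ?a"
    if "w \<in> pverts G" "S \<subseteq> pverts G" "\<And>s. s \<in> S \<Longrightarrow> (s, w) \<in> parcs G" for S w
    using card_neighbors_le_injective_chromatic_number[OF _ that] by simp
  have nbH: "card S \<le> ?b"
    if "w \<in> pverts G" "S \<subseteq> pverts G" "\<And>s. s \<in> S \<Longrightarrow> (s, w) \<in> parcs ?H" for S w
    using card_neighbors_le_injective_chromatic_number[of ?H w S] that by simp
  show ?thesis
  proof (cases "(u, v) \<in> parcs G")
    case True
    \<comment> \<open>The edge between \<open>u\<close> and \<open>v\<close> puts \<open>v\<close>
      among the neighbors of \<open>u\<close>, next to \<open>A\<close>, and \<open>u\<close> among
      those of \<open>v\<close>, next to \<open>B\<close>.\<close>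
    have "card (insert v A) \<le> ?a"
      using uv sub GA True sym by (intro nbG[of u]) auto
    moreover have "card (insert u B) \<le> ?a"
      using uv sub GB True by (intro nbG[of v]) auto
    moreover have "card A \<le> ?b" "card B \<le> ?b"
      using uv sub HA HB nbH by blast+
    ultimately show ?thesis
      using le_mult_if_split_le[of "card A" ?a "card B" ?b] fin mem n assms(2) by simp
  next
    case False
    \<comment> \<open>Now the edge lies in the complement, where \<open>A\<close> is adjacent to
      \<open>v\<close> and \<open>B\<close> to \<open>u\<close>; so the added vertices trade
      places.\<close>
    have "card (insert u A) \<le> ?b"
      using uv sub HA False by (intro nbH[of v]) (auto simp: parcs_graph_complement_iff)
    moreover have "card (insert v B) \<le> ?b"
      using uv sub HB False sym by (intro nbH[of u]) (auto simp: parcs_graph_complement_iff)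
    moreover have "card A \<le> ?a" "card B \<le> ?a"
      using uv sub GA GB nbG by blast+
    ultimately show ?thesis
      using le_mult_if_split_le[of "card A" ?b "card B" ?a] fin mem n assms(2)
      by (simp add: mult.commute)
  qed
qed

theorem theorem7:
  fixes G :: "'a pair_pre_digraph" and n :: nat
  assumes "pair_graph G" and "graph_order G = n" and "n \<ge> 5"
  shows "n \<le> injective_chromatic_number G * injective_chromatic_number (graph_complement G) \<and>
         injective_chromatic_number G * injective_chromatic_number (graph_complement G) \<le> n ^ 2"
proof
  interpret pair_graph G by (rule assms)
  let ?H = "graph_complement G"
  let ?a = "injective_chromatic_number G" and ?b = "injective_chromatic_number ?H"
  have n: "card (pverts G) = n"
    using assms(2) by (simp add: graph_order_def)
  show "?a * ?b \<le> n ^ 2"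
    using injective_chromatic_number_le_card[of G] injective_chromatic_number_le_card[of ?H] n
    by (simp add: power2_eq_square mult_le_mono)
  obtain f g where f: "injective_coloring G ?a f" and g: "injective_coloring ?H ?b g"
    using injective_chromatic_number_attained[of G] injective_chromatic_number_attained[of ?H]
    by auto
  show "n \<le> ?a * ?b"
  proof (cases "inj_on (\<lambda>x. (f x, g x)) (pverts G)")
    case True
    moreover have "(\<lambda>x. (f x, g x)) ` pverts G \<subseteq> {1..?a} \<times> {1..?b}"
      using f g by (auto simp: injective_coloring_def)
    ultimately have "card (pverts G) \<le> card ({1..?a} \<times> {1..?b})"
      by (intro card_inj_on_le) auto
    then show ?thesis using n by (simp add: card_cartesian_product)
  next
    case False
    then obtain u v where uv: "u \<in> pverts G" "v \<in> pverts G" "u \<noteq> v" "f u = f v" "g u = g v"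
      by (auto simp: inj_on_def)
    \<comment> \<open>A common neighbor in \<open>G\<close> would force \<open>f\<close> to separate
      \<open>u\<close> and \<open>v\<close>, and one in \<open>?H\<close> would force
      \<open>g\<close> to.\<close>
    then have "\<not> has_common_neighbor G u v" "\<not> has_common_neighbor ?H u v"
      using f g by (auto simp: injective_coloring_def)
    then show ?thesis
      using card_le_mult_injective_chromatic_number_if_no_common_neighbor[OF assms(1)]
        assms(3) uv n by blast
  qed
qed

end
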